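(* Let $k\ge3$ and let $m\le\left\lfloor\frac k2\right\rfloor$ be a natural number ($m\ge1$). Suppose $P$ is a $k$-gon represented by $z\in\mathbb C^k$ whose centroid is $0$. Then $$ \begin{aligned} 0\le{}&2S_{m,0}\cos^2\left(\frac\pi k\right)\left(S(P)-4\tan\left(\frac\pi k\right)F(P)\right)-S_{m,0}\left\|\boldsymbol t-2i\sin\left(\frac\pi k\right)e^{i\frac\pi k}z\right\|^2\\ &+\sum_{l=1}^{m-1}S_{m,l}\left\|D^{l-1}\left(\boldsymbol\kappa+4\sin^2\left(\frac\pi k\right)z\right)\right\|^2 . \end{aligned} $$ Equality holds if and only if the Fourier coefficients of $z$ satisfy $\zeta_\nu=0$ for $m<\nu<k-m$.
   Context: A $k$-gon $P$ is an ordered $k$-tuple $z=(z_0,\dots,z_{k-1})\in\mathbb C^k$ of points of the plane, identified with $\mathbb C$; indices are read modulo $k$. $P$ has centroid $0$ if $\sum_{\nu=0}^{k-1}z_\nu=0$. $\|\cdot\|$ is the norm of the Hermitian inner product $\langle z,w\rangle=\sum_{\nu=0}^{k-1}z_\nu\overline{w_\nu}$. The derivative is $Dz=\dot z=(z_1-z_0,z_2-z_1,\dots,z_0-z_{k-1})$, and $D^jz$ is its $j$-fold iterate ($D^0z=z$). The cyclic shift is $\tau z=(z_{k-1},z_0,z_1,\dots,z_{k-2})$. The tangent vectors are $\boldsymbol t=\dot z$ and the discrete curvature vectors are $\boldsymbol\kappa=\tau\ddot z$, i.e. $\boldsymbol\kappa_\nu=z_{\nu+1}-2z_\nu+z_{\nu-1}$.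 $S(P)=\sum_{j=0}^{k-1}|z_{j+1}-z_j|^2=\|\dot z\|^2$ is the sum of squared side lengths and $F(P)=\frac1{4i}\sum_{j=0}^{k-1}(z_{j+1}\bar z_j-z_j\bar z_{j+1})$ is the signed area. Fourier coefficients: $\zeta_\nu=\frac1k\sum_{j=0}^{k-1}z_j\,e^{-2\pi i\nu j/k}$ for $0\le\nu\le k-1$. Constants: $P_1(x)=1$ and $P_m(x)=\prod_{j=2}^m\left(x-4\sin^2\left(\frac{j\pi}k\right)\right)$ for $m\ge2$; $S_{m,0}=P_m\left(4\sin^2\left(\frac\pi k\right)\right)$; and $S_{m,1},\dots,S_{m,m-1}$ are the coefficients defined by $$\frac{P_m(x)-P_m\left(4\sin^2\left(\frac\pi k\right)\right)}{x-4\sin^2\left(\frac\pi k\right)}=\sum_{l=1}^{m-1}S_{m,l}\,x^{l-1}$$ (none for $m=1$). *)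

theory Defs
  imports Complex_Main "HOL-Computational_Algebra.Polynomial" "Jordan_Normal_Form.Matrix"
begin

text \<open>A \<open>k\<close>-gon is a vector \<open>z \<in> carrier_vec k\<close> over the complex numbers. Indices are read
  modulo \<open>dim_vec z\<close>; as they are natural numbers, the index \<open>\<nu> - 1\<close> is written
  \<open>(\<nu> + dim_vec z - 1) mod dim_vec z\<close>.\<close>

definition hnorm :: "complex vec \<Rightarrow> real" where
  "hnorm z = sqrt (Re (z \<bullet>c z))"

definition deriv_gon :: "complex vec \<Rightarrow> complex vec" where
  "deriv_gon z = vec (dim_vec z) (\<lambda>\<nu>. z $ ((\<nu> + 1) mod dim_vec z) - z $ \<nu>)"

definition shift_gon :: "complex vec \<Rightarrow> complex vec" where
  "shift_gon z = vec (dim_vec z) (\<lambda>\<nu>. z $ ((\<nu> + dim_vec z - 1) mod dim_vec z))"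

definition tangent_gon :: "complex vec \<Rightarrow> complex vec" where
  "tangent_gon z = deriv_gon z"

definition curvature_gon :: "complex vec \<Rightarrow> complex vec" where
  "curvature_gon z = shift_gon ((deriv_gon ^^ 2) z)"

definition side_sq_sum :: "complex vec \<Rightarrow> real" where
  "side_sq_sum z = (\<Sum>j<dim_vec z. (cmod (z $ ((j + 1) mod dim_vec z) - z $ j))\<^sup>2)"

text \<open>The area formula is an expression over the complex numbers with a real value
  (see \<open>of_real_signed_area\<close> below), hence \<open>Re\<close>.\<close>

definition signed_area :: "complex vec \<Rightarrow> real" where
  "signed_area z = Re (1 / (4 * \<i>) *
     (\<Sum>j<dim_vec z. z $ ((j + 1) mod dim_vec z) * cnj (z $ j)
                    - z $ j * cnj (z $ ((j + 1) mod dim_vec z))))"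

definition fourier_coeff :: "complex vec \<Rightarrow> nat \<Rightarrow> complex" where
  "fourier_coeff z \<nu> = 1 / of_nat (dim_vec z) *
     (\<Sum>j<dim_vec z. z $ j * exp (- 2 * of_real pi * \<i> * of_nat \<nu> * of_nat j / of_nat (dim_vec z)))"

definition P_poly :: "nat \<Rightarrow> nat \<Rightarrow> real poly" where
  "P_poly k m = (\<Prod>j=2..m. [:- 4 * (sin (real j * pi / real k))\<^sup>2, 1:])"

text \<open>For \<open>l \<ge> 1\<close>, the coefficients of the difference quotient of \<open>P_poly k m\<close>; the
  polynomial division is exact (see \<open>S_coeff_quotient\<close> below).\<close>

definition S_coeff :: "nat \<Rightarrow> nat \<Rightarrow> nat \<Rightarrow> real" where
  "S_coeff k m l =
     (let x1 = 4 * (sin (pi / real k))\<^sup>2; p = P_poly k m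
      in if l = 0 then poly p x1
         else coeff ((p - [:poly p x1:]) div [:- x1, 1:]) (l - 1))"

lemma curvature_gon_index:
  assumes "z \<in> carrier_vec k" and "\<nu> < k"
  shows "curvature_gon z $ \<nu> = z $ ((\<nu> + 1) mod k) - 2 * z $ \<nu> + z $ ((\<nu> + k - 1) mod k)"
proof -
  have k: "dim_vec z = k" using assms(1) by simp
  show ?thesis
  proof (cases \<nu>)
    case 0
    with assms(2) show ?thesis
      by (cases k) (auto simp: curvature_gon_def shift_gon_def deriv_gon_def k numeral_2_eq_2)
  next
    case (Suc n)
    then have "(\<nu> + k - 1) mod k = n" "n < k" "\<nu> mod k = \<nu>" using assms(2) by auto
    then show ?thesis using Suc assms(2)
      by (simp add: curvature_gon_def shift_gon_def deriv_gon_def k numeral_2_eq_2)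
  qed
qed

lemma of_real_hnorm_sq: "complex_of_real ((hnorm z)\<^sup>2) = z \<bullet>c z"
proof -
  have "z \<bullet>c z \<ge> 0" by (rule conjugate_square_ge_0_vec)
  then show ?thesis by (simp add: hnorm_def less_eq_complex_def complex_eq_iff)
qed

lemma of_real_signed_area:
  "complex_of_real (signed_area z) = 1 / (4 * \<i>) *
     (\<Sum>j<dim_vec z. z $ ((j + 1) mod dim_vec z) * cnj (z $ j)
                    - z $ j * cnj (z $ ((j + 1) mod dim_vec z)))"
proof -
  let ?s = "\<Sum>j<dim_vec z. z $ ((j + 1) mod dim_vec z) * cnj (z $ j)
                    - z $ j * cnj (z $ ((j + 1) mod dim_vec z))"
  have "Re ?s = 0" by (simp add: algebra_simps)
  then show ?thesis
    unfolding signed_area_def by (simp add: complex_eq_iff Re_divide Im_divide)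
qed

lemma S_coeff_quotient:
  assumes "m \<ge> 1" and "x \<noteq> 4 * (sin (pi / real k))\<^sup>2"
  shows "(poly (P_poly k m) x - poly (P_poly k m) (4 * (sin (pi / real k))\<^sup>2))
           / (x - 4 * (sin (pi / real k))\<^sup>2)
         = (\<Sum>l=1..m-1. S_coeff k m l * x ^ (l - 1))"
proof -
  define c where "c = 4 * (sin (pi / real k))\<^sup>2"
  define r where "r = P_poly k m - [:poly (P_poly k m) c:]"
  define q where "q = r div [:- c, 1:]"
  have "poly r c = 0" by (simp add: r_def)
  then have "[:- c, 1:] dvd r" by (simp add: poly_eq_0_iff_dvd)
  then have rq: "r = [:- c, 1:] * q"
    unfolding q_def by (rule dvd_mult_div_cancel[symmetric])
  have "degree (P_poly k m) \<le> (\<Sum>j=2..m. 1)"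
    unfolding P_poly_def by (rule order.trans[OF degree_prod_sum_le]) (auto intro!: sum_mono)
  then have degr: "degree r \<le> m - 1"
    unfolding r_def by (intro degree_diff_le) auto
  have qdeg: "coeff q i = 0" if "i \<ge> m - 1" for i
  proof (cases "q = 0")
    case False
    then have "degree r = degree q + 1" unfolding rq by (subst degree_mult_eq) auto
    then show ?thesis using degr that by (intro coeff_eq_0) auto
  qed simp
  have "poly q x = (\<Sum>i<m-1. coeff q i * x ^ i)"
    unfolding poly_altdef
    by (rule sum.mono_neutral_cong) (auto simp: coeff_eq_0 not_less qdeg)
  also have "\<dots> = (\<Sum>l=1..m-1. S_coeff k m l * x ^ (l - 1))"
    by (rule sum.reindex_bij_witness[of _ "\<lambda>l. l - 1" Suc])
       (auto simp: S_coeff_def Let_def q_def r_def c_def)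
  finally have "poly q x = (\<Sum>l=1..m-1. S_coeff k m l * x ^ (l - 1))" .
  moreover have "poly r x = (x - c) * poly q x" by (simp add: rq algebra_simps)
  ultimately show ?thesis using assms(2) by (simp add: r_def c_def field_simps)
qed

end

theory Submission
  imports Defs
begin

text \<open>The shift of a polygon is diagonalised by the discrete Fourier transform, and every
  quantity in the theorem is a Hermitian form invariant under the shift. By Parseval's
  identity the right-hand side is therefore \<open>k\<close> times a weighted sum of the \<open>\<bar>\<zeta>\<^sub>\<nu>\<bar>\<^sup>2\<close>, and only
  the weights have to be found.

  Write \<open>x\<^sub>\<nu> = 4 sin\<^sup>2 (\<nu>\<pi>/k)\<close>, which is the squared modulus of the eigenvalue of the
  derivative on mode \<open>\<nu>\<close>. A trigonometric identity (\<open>isoperimetric_mode_weight\<close>) shows that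
  the isoperimetric deficit and the tangent term, with their common factor \<open>S_coeff k m 0\<close> removed,
  contribute exactly \<open>x\<^sub>\<nu> - x\<^sub>1\<close>. On the same mode the curvature term with index \<open>l\<close> contributes
  \<open>x\<^sub>\<nu>\<^bsup>l-1\<^esup> (x\<^sub>\<nu> - x\<^sub>1)\<^sup>2\<close>. Since the \<open>S_coeff k m l\<close> are the coefficients of a difference
  quotient of \<open>P_poly k m\<close>, everything telescopes to the weight
  \<open>(x\<^sub>\<nu> - x\<^sub>1) P\<^sub>m(x\<^sub>\<nu>) = (x\<^sub>\<nu> - x\<^sub>1) (x\<^sub>\<nu> - x\<^sub>2) \<dots> (x\<^sub>\<nu> - x\<^sub>m)\<close>.

  The numbers \<open>x\<^sub>\<nu>\<close> are symmetric under \<open>\<nu> \<mapsto> k - \<nu>\<close> and strictly increasing up to \<open>k/2\<close>, so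
  the weight vanishes for \<open>1 \<le> \<nu> \<le> m\<close> and \<open>k - m \<le> \<nu> < k\<close>, and is positive in between.
  Mode \<open>0\<close>, where the sign would be \<open>(-1)\<^sup>m\<close>, is absent because the centroid is \<open>0\<close>. Both the
  inequality and the equality case follow.\<close>

section \<open>Roots of unity and Parseval's identity\<close>

definition unity_root :: "nat \<Rightarrow> nat \<Rightarrow> complex" where
  "unity_root k \<nu> = cis (2 * pi * real \<nu> / real k)"

lemma cnj_unity_root_mult [simp]: "cnj (unity_root k \<nu>) * unity_root k \<nu> = 1"
  by (simp add: unity_root_def cis_cnj cis_mult)

lemma unity_root_power_swap: "unity_root k \<nu> ^ j = unity_root k j ^ \<nu>"
  by (simp add: unity_root_def DeMoivre algebra_simps)

lemma unity_root_power_order: "k > 0 \<Longrightarrow> unity_root k \<nu> ^ k = 1"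
  using cis_multiple_2pi[of "real \<nu>"] by (simp add: unity_root_def DeMoivre)

lemma unity_root_inject:
  assumes "j < k" "l < k" "unity_root k j = unity_root k l"
  shows "j = l"
  using bij_betw_imp_inj_on[OF bij_betw_roots_unity[of k]] assms
  by (auto simp: unity_root_def inj_on_def)

text \<open>The sum is geometric with ratio \<open>\<omega>\<^bsup>l-j\<^esup>\<close>, where \<open>\<omega> = unity_root k 1\<close>. Its \<open>k\<close>-th power is
  \<open>1\<close>, so the sum collapses unless the ratio itself is \<open>1\<close>, which forces \<open>j = l\<close>.\<close>

lemma unity_root_orthogonal:
  assumes "j < k" "l < k"
  shows "(\<Sum>\<nu><k. cnj (unity_root k \<nu>) ^ j * unity_root k \<nu> ^ l) = (if j = l then of_nat k else 0)"
proof -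
  define q where "q = cnj (unity_root k j) * unity_root k l"
  have "(\<Sum>\<nu><k. cnj (unity_root k \<nu>) ^ j * unity_root k \<nu> ^ l) = (\<Sum>\<nu><k. q ^ \<nu>)"
    by (intro sum.cong refl)
       (metis complex_cnj_power power_mult_distrib q_def unity_root_power_swap)
  also have "\<dots> = (if j = l then of_nat k else 0)"
  proof (cases "j = l")
    case True
    then show ?thesis by (simp add: q_def)
  next
    case False
    have "q \<noteq> 1"
    proof
      assume "q = 1"
      then have "unity_root k j * cnj (unity_root k j) * unity_root k l = unity_root k j"
        by (simp add: q_def mult.assoc)
      then have "unity_root k l = unity_root k j"
        by (simp add: mult.commute[of "unity_root k j"])
      with False show False using unity_root_inject[of l k j] assms by simp
    qed
    moreover have "q ^ k = 1"
      using assms unity_root_power_order[of k]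
      by (simp add: q_def power_mult_distrib flip: complex_cnj_power)
    ultimately show ?thesis using False geometric_sum[of q k] by simp
  qed
  finally show ?thesis .
qed

lemma fourier_coeff_unity_root:
  assumes "z \<in> carrier_vec k"
  shows "fourier_coeff z \<nu> = 1 / of_nat k * (\<Sum>j<k. z $ j * cnj (unity_root k \<nu>) ^ j)"
proof -
  have "exp (- 2 * of_real pi * \<i> * of_nat \<nu> * of_nat j / of_nat k) = cnj (unity_root k \<nu>) ^ j" for j
  proof -
    have "cnj (unity_root k \<nu>) ^ j = cis (- 2 * pi * real \<nu> * real j / real k)"
      by (simp add: unity_root_def cis_cnj DeMoivre mult_ac)
    then show ?thesis by (simp add: cis_conv_exp mult_ac)
  qed
  then show ?thesis using assms by (simp add: fourier_coeff_def)
qed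

text \<open>The polarised form is needed because the area is the imaginary part of the inner product of
  two different polygons, \<open>z\<close> and its cyclic shift.\<close>

lemma parseval_inner:
  assumes z: "z \<in> carrier_vec k" and w: "w \<in> carrier_vec k" and k: "k > 0"
  shows "z \<bullet>c w = of_nat k * (\<Sum>\<nu><k. fourier_coeff z \<nu> * cnj (fourier_coeff w \<nu>))"
proof -
  let ?e = "\<lambda>j l \<nu>. cnj (unity_root k \<nu>) ^ j * unity_root k \<nu> ^ l"
  have "fourier_coeff z \<nu> * cnj (fourier_coeff w \<nu>) =
      1 / (of_nat k)\<^sup>2 * (\<Sum>j<k. \<Sum>l<k. z $ j * cnj (w $ l) * ?e j l \<nu>)" for \<nu>
    unfolding fourier_coeff_unity_root[OF z] fourier_coeff_unity_root[OF w]
    by (simp add: sum_product power2_eq_square mult_ac)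
  then have "(\<Sum>\<nu><k. fourier_coeff z \<nu> * cnj (fourier_coeff w \<nu>)) =
      1 / (of_nat k)\<^sup>2 * (\<Sum>\<nu><k. \<Sum>j<k. \<Sum>l<k. z $ j * cnj (w $ l) * ?e j l \<nu>)"
    by (simp add: sum_distrib_left)
  also have "(\<Sum>\<nu><k. \<Sum>j<k. \<Sum>l<k. z $ j * cnj (w $ l) * ?e j l \<nu>) =
      (\<Sum>j<k. \<Sum>\<nu><k. \<Sum>l<k. z $ j * cnj (w $ l) * ?e j l \<nu>)"
    by (rule sum.swap)
  also have "\<dots> = (\<Sum>j<k. \<Sum>l<k. \<Sum>\<nu><k. z $ j * cnj (w $ l) * ?e j l \<nu>)"
    by (rule sum.cong[OF refl]) (rule sum.swap)
  also have "\<dots> = (\<Sum>j<k. \<Sum>l<k. z $ j * cnj (w $ l) * (if j = l then of_nat k else 0))"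
    by (intro sum.cong refl) (simp add: unity_root_orthogonal flip: sum_distrib_left)
  also have "\<dots> = (\<Sum>j<k. z $ j * cnj (w $ j) * of_nat k)"
    by (intro sum.cong refl) (simp add: if_distrib[of "\<lambda>x. _ * x"] cong: if_cong)
  also have "\<dots> = of_nat k * (z \<bullet>c w)"
    using z w by (simp add: scalar_prod_def sum_distrib_left mult_ac lessThan_atLeast0)
  finally show ?thesis using k by (simp add: power2_eq_square)
qed

lemma parseval:
  assumes "z \<in> carrier_vec k" "k > 0"
  shows "(hnorm z)\<^sup>2 = real k * (\<Sum>\<nu><k. (cmod (fourier_coeff z \<nu>))\<^sup>2)"
proof -
  have "complex_of_real ((hnorm z)\<^sup>2) =
      complex_of_real (real k * (\<Sum>\<nu><k. (cmod (fourier_coeff z \<nu>))\<^sup>2))"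
    unfolding of_real_hnorm_sq parseval_inner[OF assms(1,1,2)]
    by (simp flip: complex_norm_square)
  then show ?thesis by (simp only: of_real_eq_iff)
qed

section \<open>The operators on polygons as Fourier multipliers\<close>

lemma fourier_coeff_add:
  assumes "z \<in> carrier_vec k" "w \<in> carrier_vec k"
  shows "fourier_coeff (z + w) \<nu> = fourier_coeff z \<nu> + fourier_coeff w \<nu>"
  using assms
  by (simp add: fourier_coeff_unity_root[of _ k] ring_distribs sum.distrib add_divide_distrib)

lemma fourier_coeff_smult:
  assumes "z \<in> carrier_vec k"
  shows "fourier_coeff (a \<cdot>\<^sub>v z) \<nu> = a * fourier_coeff z \<nu>"
  using assms
  by (simp add: fourier_coeff_unity_root[of _ k] sum_distrib_left mult_ac)

lemma fourier_coeff_diff: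
  assumes "z \<in> carrier_vec k" "w \<in> carrier_vec k"
  shows "fourier_coeff (z - w) \<nu> = fourier_coeff z \<nu> - fourier_coeff w \<nu>"
  using assms
  by (simp add: fourier_coeff_unity_root[of _ k] ring_distribs sum_subtractf diff_divide_distrib)

text \<open>The inverse of \<open>shift_gon\<close>; it occurs in the derivative and in the area.\<close>

definition next_gon :: "complex vec \<Rightarrow> complex vec" where
  "next_gon z = vec (dim_vec z) (\<lambda>\<nu>. z $ ((\<nu> + 1) mod dim_vec z))"

lemma next_gon_carrier [simp]: "z \<in> carrier_vec k \<Longrightarrow> next_gon z \<in> carrier_vec k"
  and deriv_gon_carrier [simp]: "z \<in> carrier_vec k \<Longrightarrow> deriv_gon z \<in> carrier_vec k"
  and shift_gon_carrier [simp]: "z \<in> carrier_vec k \<Longrightarrow> shift_gon z \<in> carrier_vec k"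
  by (auto simp: next_gon_def deriv_gon_def shift_gon_def intro!: carrier_vecI)

lemma deriv_gon_funpow_carrier [simp]:
  "z \<in> carrier_vec k \<Longrightarrow> (deriv_gon ^^ n) z \<in> carrier_vec k"
  by (induction n) auto

lemma curvature_gon_carrier [simp]: "z \<in> carrier_vec k \<Longrightarrow> curvature_gon z \<in> carrier_vec k"
  by (simp add: curvature_gon_def)

lemma deriv_gon_eq: "deriv_gon z = next_gon z - z"
  by (rule eq_vecI) (auto simp: deriv_gon_def next_gon_def)

lemma next_gon_shift_gon: "next_gon (shift_gon z) = z"
proof (rule eq_vecI)
  fix i assume "i < dim_vec z"
  moreover from this have "((i + 1) mod dim_vec z + dim_vec z - 1) mod dim_vec z = i"
    by (cases "i + 1 = dim_vec z") auto
  ultimately show "next_gon (shift_gon z) $ i = z $ i"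
    by (auto simp: next_gon_def shift_gon_def)
qed (simp add: next_gon_def shift_gon_def)

lemma sum_cyclic_shift:
  fixes f :: "nat \<Rightarrow> 'a :: comm_monoid_add"
  shows "(\<Sum>j<k. f ((j + 1) mod k)) = (\<Sum>j<k. f j)"
proof (cases k)
  case (Suc n)
  have "(\<Sum>j<n. f ((j + 1) mod Suc n)) = (\<Sum>j<n. f (Suc j))"
    by (intro sum.cong) auto
  then show ?thesis
    unfolding Suc sum.lessThan_Suc_shift[of f] by (simp add: add.commute)
qed simp

lemma fourier_coeff_next_gon:
  assumes z: "z \<in> carrier_vec k" and k: "k > 0"
  shows "fourier_coeff (next_gon z) \<nu> = unity_root k \<nu> * fourier_coeff z \<nu>"
proof -
  let ?r = "unity_root k \<nu>"
  have period: "cnj ?r ^ (n mod k) = cnj ?r ^ n" for n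
  proof -
    have "cnj ?r ^ k = 1"
      using unity_root_power_order[OF k] by (simp flip: complex_cnj_power)
    then have "cnj ?r ^ (k * (n div k) + n mod k) = cnj ?r ^ (n mod k)"
      by (simp only: power_add power_mult power_one mult_1_left)
    then show ?thesis by simp
  qed
  have "next_gon z $ j * cnj ?r ^ j = ?r * (z $ ((j + 1) mod k) * cnj ?r ^ ((j + 1) mod k))"
    if "j < k" for j
  proof -
    have "?r * (z $ ((j + 1) mod k) * cnj ?r ^ ((j + 1) mod k)) =
        (cnj ?r * ?r) * (z $ ((j + 1) mod k) * cnj ?r ^ j)"
      unfolding period by (simp only: power_add power_one_right mult_ac)
    then show ?thesis using that z by (auto simp: next_gon_def)
  qed
  then have "(\<Sum>j<k. next_gon z $ j * cnj ?r ^ j) =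
      ?r * (\<Sum>j<k. z $ ((j + 1) mod k) * cnj ?r ^ ((j + 1) mod k))"
    by (simp add: sum_distrib_left)
  also have "(\<Sum>j<k. z $ ((j + 1) mod k) * cnj ?r ^ ((j + 1) mod k)) = (\<Sum>j<k. z $ j * cnj ?r ^ j)"
    by (rule sum_cyclic_shift)
  finally show ?thesis using z by (simp add: fourier_coeff_unity_root[of _ k])
qed

text \<open>Shifting forward and back is the identity, so the two multipliers are inverse to each other;
  on the unit circle the inverse is the conjugate.\<close>

lemma fourier_coeff_shift_gon:
  assumes "z \<in> carrier_vec k" "k > 0"
  shows "fourier_coeff (shift_gon z) \<nu> = cnj (unity_root k \<nu>) * fourier_coeff z \<nu>"
proof -
  have "fourier_coeff z \<nu> = unity_root k \<nu> * fourier_coeff (shift_gon z) \<nu>"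
    using fourier_coeff_next_gon[of "shift_gon z" k \<nu>] assms by (simp add: next_gon_shift_gon)
  then show ?thesis by (simp flip: mult.assoc)
qed

lemma fourier_coeff_deriv_gon:
  assumes "z \<in> carrier_vec k" "k > 0"
  shows "fourier_coeff (deriv_gon z) \<nu> = (unity_root k \<nu> - 1) * fourier_coeff z \<nu>"
  using assms
  by (simp add: deriv_gon_eq fourier_coeff_diff[of _ k] fourier_coeff_next_gon[of _ k] algebra_simps)

lemma fourier_coeff_deriv_gon_funpow:
  assumes "z \<in> carrier_vec k" "k > 0"
  shows "fourier_coeff ((deriv_gon ^^ n) z) \<nu> = (unity_root k \<nu> - 1) ^ n * fourier_coeff z \<nu>"
  by (induction n) (simp_all add: fourier_coeff_deriv_gon[of _ k] assms)

text \<open>The squared modulus of the eigenvalue of the derivative, that is, the negative of the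
  eigenvalue of the curvature operator.\<close>

definition laplace_eigenvalue :: "nat \<Rightarrow> nat \<Rightarrow> real" where
  "laplace_eigenvalue k \<nu> = 4 * (sin (real \<nu> * pi / real k))\<^sup>2"

lemma unity_root_minus_1:
  "unity_root k \<nu> - 1 =
     2 * \<i> * complex_of_real (sin (real \<nu> * pi / real k)) * cis (real \<nu> * pi / real k)"
proof -
  define a where "a = real \<nu> * pi / real k"
  have a: "unity_root k \<nu> = cis (2 * a)"
    by (simp add: unity_root_def a_def mult_ac)
  have "cis (2 * a) - 1 = 2 * \<i> * complex_of_real (sin a) * cis a"
    by (simp add: complex_eq_iff cos_double_sin sin_double power2_eq_square)
  then show ?thesis unfolding a by (simp only: a_def)
qed

lemma cmod_unity_root_minus_1: "(cmod (unity_root k \<nu> - 1))\<^sup>2 = laplace_eigenvalue k \<nu>"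
  by (simp add: unity_root_minus_1 norm_mult laplace_eigenvalue_def power_mult_distrib)

text \<open>The curvature operator is the second derivative shifted back by one index, so its
  multiplier is \<open>cnj r * (r - 1)\<^sup>2\<close> for a root of unity \<open>r\<close>; since \<open>cnj r * (r - 1) = - cnj (r - 1)\<close>,
  this is \<open>- \<bar>r - 1\<bar>\<^sup>2\<close>.\<close>

lemma fourier_coeff_curvature_gon:
  assumes "z \<in> carrier_vec k" "k > 0"
  shows "fourier_coeff (curvature_gon z) \<nu> =
    - complex_of_real (laplace_eigenvalue k \<nu>) * fourier_coeff z \<nu>"
proof -
  let ?r = "unity_root k \<nu>"
  have "cnj ?r * (?r - 1) = - cnj (?r - 1)"
    using cnj_unity_root_mult[of k \<nu>]
    by (simp add: algebra_simps del: cnj_unity_root_mult)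
  then have "cnj ?r * (?r - 1) * (?r - 1) = - ((?r - 1) * cnj (?r - 1))"
    by (simp only: mult_minus_left mult_minus_right mult.commute)
  then have "cnj ?r * (?r - 1)\<^sup>2 = - ((?r - 1) * cnj (?r - 1))"
    by (simp only: power2_eq_square mult.assoc)
  also have "\<dots> = - complex_of_real (laplace_eigenvalue k \<nu>)"
    by (simp only: complex_norm_square[symmetric] cmod_unity_root_minus_1)
  finally show ?thesis
    using assms
    by (simp add: curvature_gon_def fourier_coeff_shift_gon[of _ k] fourier_coeff_deriv_gon_funpow[of _ k]
        flip: mult.assoc)
qed

section \<open>The terms of the inequality in Fourier coordinates\<close>

lemma side_sq_sum_fourier:
  assumes z: "z \<in> carrier_vec k" and k: "k > 0"
  shows "side_sq_sum z =
    real k * (\<Sum>\<nu><k. laplace_eigenvalue k \<nu> * (cmod (fourier_coeff z \<nu>))\<^sup>2)"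
proof -
  have "complex_of_real (side_sq_sum z) = deriv_gon z \<bullet>c deriv_gon z"
    using z
    by (simp add: side_sq_sum_def scalar_prod_def deriv_gon_def lessThan_atLeast0
        flip: complex_norm_square complex_cnj_diff)
  then have "side_sq_sum z = (hnorm (deriv_gon z))\<^sup>2"
    by (simp only: of_real_hnorm_sq[symmetric] of_real_eq_iff)
  also have "\<dots> = real k * (\<Sum>\<nu><k. laplace_eigenvalue k \<nu> * (cmod (fourier_coeff z \<nu>))\<^sup>2)"
    using z k by (simp add: parseval[of _ k] fourier_coeff_deriv_gon[of _ k] norm_mult power_mult_distrib
        cmod_unity_root_minus_1)
  finally show ?thesis .
qed

text \<open>The area is half the imaginary part of the inner product of \<open>next_gon z\<close> with \<open>z\<close>, and on mode
  \<open>\<nu>\<close> that inner product is weighted by the eigenvalue of \<open>next_gon\<close>, a point of the unit circle.\<close>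

lemma signed_area_fourier:
  assumes z: "z \<in> carrier_vec k" and k: "k > 0"
  shows "signed_area z =
    real k / 2 * (\<Sum>\<nu><k. sin (2 * pi * real \<nu> / real k) * (cmod (fourier_coeff z \<nu>))\<^sup>2)"
proof -
  let ?u = "next_gon z \<bullet>c z"
  have "signed_area z = Re (1 / (4 * \<i>) * (?u - cnj ?u))"
    using z by (simp add: signed_area_def scalar_prod_def next_gon_def lessThan_atLeast0
        sum_subtractf mult.commute)
  also have "\<dots> = Im ?u / 2"
    by (simp add: Re_divide)
  also have "?u = of_nat k * (\<Sum>\<nu><k. unity_root k \<nu> * complex_of_real ((cmod (fourier_coeff z \<nu>))\<^sup>2))"
    using z k by (simp add: parseval_inner[of _ k] fourier_coeff_next_gon[of _ k] mult.assoc
        flip: complex_norm_square)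
  also have "Im \<dots> / 2 =
      real k / 2 * (\<Sum>\<nu><k. sin (2 * pi * real \<nu> / real k) * (cmod (fourier_coeff z \<nu>))\<^sup>2)"
    by (simp add: unity_root_def)
  finally show ?thesis .
qed

lemma tangent_defect_fourier:
  assumes z: "z \<in> carrier_vec k" and k: "k > 0"
  shows "(hnorm (tangent_gon z - a \<cdot>\<^sub>v z))\<^sup>2 =
    real k * (\<Sum>\<nu><k. (cmod (unity_root k \<nu> - 1 - a))\<^sup>2 * (cmod (fourier_coeff z \<nu>))\<^sup>2)"
proof -
  have "fourier_coeff (tangent_gon z - a \<cdot>\<^sub>v z) \<nu> = (unity_root k \<nu> - 1 - a) * fourier_coeff z \<nu>" for \<nu>
    using z k by (simp add: tangent_gon_def fourier_coeff_diff[of _ k] fourier_coeff_smult[of _ k]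
        fourier_coeff_deriv_gon[of _ k] algebra_simps)
  then show ?thesis
    using z k by (simp add: tangent_gon_def parseval[of _ k] norm_mult power_mult_distrib)
qed

text \<open>On mode \<open>\<nu>\<close> the curvature operator is multiplication by \<open>- laplace_eigenvalue k \<nu>\<close>, so adding
  \<open>c z\<close> leaves the factor \<open>c - laplace_eigenvalue k \<nu>\<close>; each derivative multiplies the squared
  modulus by one further eigenvalue.\<close>

lemma curvature_defect_fourier:
  assumes z: "z \<in> carrier_vec k" and k: "k > 0"
  shows "(hnorm ((deriv_gon ^^ n) (curvature_gon z + complex_of_real c \<cdot>\<^sub>v z)))\<^sup>2 =
    real k * (\<Sum>\<nu><k. laplace_eigenvalue k \<nu> ^ n * (laplace_eigenvalue k \<nu> - c)\<^sup>2
      * (cmod (fourier_coeff z \<nu>))\<^sup>2)"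
proof -
  have "fourier_coeff ((deriv_gon ^^ n) (curvature_gon z + complex_of_real c \<cdot>\<^sub>v z)) \<nu> =
      (unity_root k \<nu> - 1) ^ n * complex_of_real (c - laplace_eigenvalue k \<nu>) * fourier_coeff z \<nu>" for \<nu>
    using z k by (simp add: fourier_coeff_add[of _ k] fourier_coeff_smult[of _ k]
        fourier_coeff_deriv_gon_funpow[of _ k] fourier_coeff_curvature_gon[of _ k] algebra_simps)
  moreover have "(cmod ((unity_root k \<nu> - 1) ^ n))\<^sup>2 = laplace_eigenvalue k \<nu> ^ n" for \<nu>
    by (simp add: norm_power power_mult[symmetric] mult.commute flip: cmod_unity_root_minus_1)
  ultimately show ?thesis
    using z k by (simp add: parseval[of _ k] norm_mult power_mult_distrib power2_commute[of c]
        del: of_real_diff)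
qed

section \<open>The weight of a single mode\<close>

text \<open>With \<open>\<theta> = \<pi>/k\<close>, the squared modulus equals
  \<open>4 (sin\<^sup>2 (\<nu>\<theta>) + sin\<^sup>2 \<theta> - 2 sin \<theta> sin (\<nu>\<theta>) cos ((\<nu> - 1)\<theta>))\<close>. Expanding the last cosine shows
  that the mixed products \<open>sin (\<nu>\<theta>) cos (\<nu>\<theta>)\<close>, the only terms that distinguish mode \<open>\<nu>\<close> from mode
  \<open>k - \<nu>\<close>, cancel against those of the area.\<close>

lemma isoperimetric_mode_weight:
  assumes k: "k \<ge> 3"
  shows "2 * (cos (pi / real k))\<^sup>2
      * (laplace_eigenvalue k \<nu> - 2 * tan (pi / real k) * sin (2 * pi * real \<nu> / real k))
    - (cmod (unity_root k \<nu> - 1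
        - 2 * \<i> * complex_of_real (sin (pi / real k)) * exp (\<i> * complex_of_real (pi / real k))))\<^sup>2
    = laplace_eigenvalue k \<nu> - laplace_eigenvalue k 1"
proof -
  define t where "t = pi / real k"
  define a where "a = real \<nu> * pi / real k"
  have "0 < t" "t < pi / 2" using k by (auto simp: t_def field_simps)
  \<comment> \<open>This is where \<open>k \<ge> 3\<close> enters: the tangent is a genuine quotient.\<close>
  then have c: "cos t \<noteq> 0" using cos_gt_zero_pi[of t] by simp
  \<comment> \<open>For \<open>p, c = sin t, cos t\<close> and \<open>q, d = sin a, cos a\<close> the left-hand side is the squared modulus
      below. The right-hand side keeps \<open>sin\<^sup>2 + cos\<^sup>2\<close> visible, so that it can be replaced by \<open>1\<close>.\<close>
  have expand: "(2 * p * p - 2 * q * q)\<^sup>2 + (2 * q * d - 2 * p * c)\<^sup>2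
      = 4 * (q\<^sup>2 * (q\<^sup>2 + d\<^sup>2) + p\<^sup>2 * (p\<^sup>2 + c\<^sup>2) - 2 * p * q * (d * c + q * p))"
    for p q c d :: real
    by (simp add: power2_eq_square algebra_simps)
  have dev: "2 * (cos t)\<^sup>2 * (4 * (sin a)\<^sup>2 - 2 * tan t * sin (2 * a))
      = 8 * (cos t)\<^sup>2 * (sin a)\<^sup>2 - 8 * sin t * cos t * sin a * cos a"
    unfolding sin_double using c by (simp add: tan_def field_simps power2_eq_square)
  have tang: "(cmod (2 * \<i> * complex_of_real (sin a) * cis a
        - 2 * \<i> * complex_of_real (sin t) * cis t))\<^sup>2
      = 4 * ((sin a)\<^sup>2 + (sin t)\<^sup>2 - 2 * sin t * sin a * (cos a * cos t + sin a * sin t))"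
  proof -
    have "(cmod (2 * \<i> * complex_of_real (sin a) * cis a
        - 2 * \<i> * complex_of_real (sin t) * cis t))\<^sup>2
      = (2 * sin t * sin t - 2 * sin a * sin a)\<^sup>2 + (2 * sin a * cos a - 2 * sin t * cos t)\<^sup>2"
      by (simp add: cmod_power2)
    also have "\<dots> = 4 * ((sin a)\<^sup>2 * ((sin a)\<^sup>2 + (cos a)\<^sup>2) + (sin t)\<^sup>2 * ((sin t)\<^sup>2 + (cos t)\<^sup>2)
        - 2 * sin t * sin a * (cos a * cos t + sin a * sin t))"
      by (rule expand)
    finally show ?thesis by simp
  qed
  have "2 * (cos t)\<^sup>2 * (4 * (sin a)\<^sup>2 - 2 * tan t * sin (2 * a))
     - (cmod (2 * \<i> * complex_of_real (sin a) * cis a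
          - 2 * \<i> * complex_of_real (sin t) * cis t))\<^sup>2
     = 8 * (cos t)\<^sup>2 * (sin a)\<^sup>2 + 8 * (sin t)\<^sup>2 * (sin a)\<^sup>2 - 4 * (sin a)\<^sup>2 - 4 * (sin t)\<^sup>2"
    unfolding dev tang
    by (simp add: power2_eq_square algebra_simps)
  also have "\<dots> = 4 * (sin a)\<^sup>2 - 4 * (sin t)\<^sup>2"
    by (simp add: cos_squared_eq algebra_simps)
  finally have "2 * (cos t)\<^sup>2 * (4 * (sin a)\<^sup>2 - 2 * tan t * sin (2 * a))
     - (cmod (2 * \<i> * complex_of_real (sin a) * cis a
          - 2 * \<i> * complex_of_real (sin t) * cis t))\<^sup>2 = 4 * (sin a)\<^sup>2 - 4 * (sin t)\<^sup>2" .
  moreover have "2 * pi * real \<nu> / real k = 2 * a" by (simp add: a_def mult_ac)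
  ultimately show ?thesis
    unfolding unity_root_minus_1 laplace_eigenvalue_def cis_conv_exp[symmetric]
    by (simp add: t_def[symmetric] a_def[symmetric])
qed

lemma poly_P_poly: "poly (P_poly k m) x = (\<Prod>j=2..m. x - laplace_eigenvalue k j)"
  by (simp add: P_poly_def poly_prod laplace_eigenvalue_def)

text \<open>The division-free form of the difference quotient. Unlike the quotient, it may be evaluated at
  \<open>laplace_eigenvalue k 1\<close>, which modes \<open>1\<close> and \<open>k - 1\<close> require.\<close>

lemma P_poly_expansion:
  assumes "m \<ge> 1"
  shows "S_coeff k m 0 + (\<Sum>l=1..m-1. S_coeff k m l * x ^ (l - 1)) * (x - laplace_eigenvalue k 1)
    = poly (P_poly k m) x"
proof (cases "x = laplace_eigenvalue k 1")
  case True
  then show ?thesis by (simp add: S_coeff_def laplace_eigenvalue_def)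
next
  case False
  then show ?thesis
    using S_coeff_quotient[OF assms, of x k]
    by (simp add: S_coeff_def laplace_eigenvalue_def field_simps)
qed

definition mode_weight :: "nat \<Rightarrow> nat \<Rightarrow> nat \<Rightarrow> real" where
  "mode_weight k m \<nu> = (\<Prod>j=1..m. laplace_eigenvalue k \<nu> - laplace_eigenvalue k j)"

text \<open>Factoring out \<open>x \<nu> - x 1\<close> leaves the expansion of \<open>P_poly k m\<close> at \<open>x \<nu>\<close>. The factor
  taken out is the one with \<open>j = 1\<close> that is missing from the product defining \<open>P_poly\<close>.\<close>

lemma mode_weight_S_coeff:
  fixes k m \<nu> :: nat
  assumes "m \<ge> 1"
  defines "x \<equiv> laplace_eigenvalue k"
  shows "S_coeff k m 0 * (x \<nu> - x 1)
    + (\<Sum>l=1..m-1. S_coeff k m l * (x \<nu> ^ (l - 1) * (x \<nu> - x 1)\<^sup>2)) = mode_weight k m \<nu>"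
proof -
  have "S_coeff k m 0 * (x \<nu> - x 1)
      + (\<Sum>l=1..m-1. S_coeff k m l * (x \<nu> ^ (l - 1) * (x \<nu> - x 1)\<^sup>2))
    = (x \<nu> - x 1) * (S_coeff k m 0 + (\<Sum>l=1..m-1. S_coeff k m l * x \<nu> ^ (l - 1)) * (x \<nu> - x 1))"
    by (simp add: ring_distribs sum_distrib_left sum_distrib_right power2_eq_square mult_ac)
  also have "\<dots> = (x \<nu> - x 1) * (\<Prod>j=2..m. x \<nu> - x j)"
    unfolding x_def P_poly_expansion[OF assms(1)] poly_P_poly ..
  also have "\<dots> = mode_weight k m \<nu>"
    using assms(1) by (simp add: mode_weight_def x_def prod.atLeast_Suc_atMost numeral_2_eq_2)
  finally show ?thesis .
qed

lemma laplace_eigenvalue_reflect: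
  assumes "\<nu> \<le> k" "k > 0"
  shows "laplace_eigenvalue k (k - \<nu>) = laplace_eigenvalue k \<nu>"
proof -
  have "real (k - \<nu>) * pi / real k = pi - real \<nu> * pi / real k"
    using assms by (simp add: of_nat_diff field_simps)
  then show ?thesis by (simp add: laplace_eigenvalue_def)
qed

lemma laplace_eigenvalue_strict_mono:
  assumes "i < j" "2 * j \<le> k"
  shows "laplace_eigenvalue k i < laplace_eigenvalue k j"
proof -
  have k: "k > 0" using assms by simp
  have j: "real j * pi / real k \<le> pi / 2"
    using k mult_right_mono[of "real (2 * j)" "real k" pi] assms(2) by (simp add: field_simps)
  have ij: "real i * pi / real k < real j * pi / real k"
    using assms k by (simp add: divide_strict_right_mono)
  have i: "0 \<le> real i * pi / real k" by simp
  have "sin (real i * pi / real k) < sin (real j * pi / real k)"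
    by (rule sin_monotone_2pi) (use i j ij pi_gt_zero in linarith)+
  moreover have "0 \<le> sin (real i * pi / real k)"
    by (rule sin_ge_zero) (use i j ij pi_gt_zero in linarith)+
  ultimately show ?thesis by (simp add: laplace_eigenvalue_def power_strict_mono)
qed

text \<open>By the reflection symmetry \<open>\<nu>\<close> may be taken in the lower half, where monotonicity makes every
  factor positive.\<close>

lemma mode_weight_pos:
  assumes "m < \<nu>" "\<nu> < k - m"
  shows "mode_weight k m \<nu> > 0"
  unfolding mode_weight_def
proof (rule prod_pos)
  fix j assume j: "j \<in> {1..m}"
  show "0 < laplace_eigenvalue k \<nu> - laplace_eigenvalue k j"
  proof (cases "2 * \<nu> \<le> k")
    case True
    then show ?thesis using laplace_eigenvalue_strict_mono[of j \<nu> k] j assms by simp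
  next
    case False
    then have "2 * (k - \<nu>) \<le> k" "j < k - \<nu>" using j assms by auto
    then show ?thesis
      using laplace_eigenvalue_strict_mono[of j "k - \<nu>" k] laplace_eigenvalue_reflect[of \<nu> k] j assms
      by simp
  qed
qed

lemma mode_weight_zero:
  assumes "0 < \<nu>" "\<nu> < k" "\<not> (m < \<nu> \<and> \<nu> < k - m)"
  shows "mode_weight k m \<nu> = 0"
proof -
  have "\<exists>j\<in>{1..m}. laplace_eigenvalue k \<nu> = laplace_eigenvalue k j"
  proof (cases "\<nu> \<le> m")
    case True
    then show ?thesis using assms by (intro bexI[of _ \<nu>]) auto
  next
    case False
    then show ?thesis using assms laplace_eigenvalue_reflect[of \<nu> k]
      by (intro bexI[of _ "k - \<nu>"]) auto
  qed
  then show ?thesis by (auto simp: mode_weight_def)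
qed

section \<open>The isoperimetric inequality\<close>

theorem theorem4:
  fixes k m :: nat and z :: "complex vec"
  assumes "k \<ge> 3" and "1 \<le> m" and "m \<le> k div 2"
    and "z \<in> carrier_vec k"
    and "(\<Sum>\<nu><k. z $ \<nu>) = 0"
  shows "let rhs =
      2 * S_coeff k m 0 * (cos (pi / real k))\<^sup>2
        * (side_sq_sum z - 4 * tan (pi / real k) * signed_area z)
      - S_coeff k m 0
        * (hnorm (tangent_gon z
             - (2 * \<i> * complex_of_real (sin (pi / real k))
                  * exp (\<i> * complex_of_real (pi / real k))) \<cdot>\<^sub>v z))\<^sup>2
      + (\<Sum>l=1..m-1. S_coeff k m l
          * (hnorm ((deriv_gon ^^ (l - 1))
               (curvature_gon z
                + complex_of_real (4 * (sin (pi / real k))\<^sup>2) \<cdot>\<^sub>v z)))\<^sup>2)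
    in 0 \<le> rhs \<and> (rhs = 0 \<longleftrightarrow> (\<forall>\<nu>. m < \<nu> \<and> \<nu> < k - m \<longrightarrow> fourier_coeff z \<nu> = 0))"
proof -
  have k: "k > 0" using assms(1) by simp
  note z = assms(4)
  let ?x = "laplace_eigenvalue k"
  let ?S = "S_coeff k m"
  let ?a = "2 * \<i> * complex_of_real (sin (pi / real k)) * exp (\<i> * complex_of_real (pi / real k))"
  define E where "E \<nu> = (cmod (fourier_coeff z \<nu>))\<^sup>2" for \<nu>
  define isop where "isop = 2 * ?S 0 * (cos (pi / real k))\<^sup>2
        * (side_sq_sum z - 4 * tan (pi / real k) * signed_area z)
      - ?S 0 * (hnorm (tangent_gon z - ?a \<cdot>\<^sub>v z))\<^sup>2"
  define curv where "curv = (\<Sum>l=1..m-1. ?S l * (hnorm ((deriv_gon ^^ (l - 1))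
      (curvature_gon z + complex_of_real (4 * (sin (pi / real k))\<^sup>2) \<cdot>\<^sub>v z)))\<^sup>2)"
  define y where "y \<nu> = (cmod (unity_root k \<nu> - 1 - ?a))\<^sup>2" for \<nu>
  have "isop = real k * (\<Sum>\<nu><k. ?S 0 * (2 * (cos (pi / real k))\<^sup>2
        * (?x \<nu> - 2 * tan (pi / real k) * sin (2 * pi * real \<nu> / real k))
      - y \<nu>) * E \<nu>)"
    unfolding isop_def side_sq_sum_fourier[OF z k] signed_area_fourier[OF z k]
      tangent_defect_fourier[OF z k] E_def[symmetric] y_def[symmetric]
    by (simp add: left_diff_distrib right_diff_distrib sum_subtractf sum_distrib_left mult_ac)
  also have "\<dots> = real k * (\<Sum>\<nu><k. ?S 0 * (?x \<nu> - ?x 1) * E \<nu>)"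
    unfolding y_def isoperimetric_mode_weight[OF assms(1)] ..
  finally have isop: "isop = real k * (\<Sum>\<nu><k. ?S 0 * (?x \<nu> - ?x 1) * E \<nu>)" .
  have x1: "4 * (sin (pi / real k))\<^sup>2 = ?x 1" by (simp add: laplace_eigenvalue_def)
  have "curv = (\<Sum>l=1..m-1. \<Sum>\<nu><k. real k * (?S l * (?x \<nu> ^ (l - 1) * (?x \<nu> - ?x 1)\<^sup>2) * E \<nu>))"
    unfolding curv_def curvature_defect_fourier[OF z k] x1 E_def[symmetric]
    by (simp add: sum_distrib_left mult_ac)
  also have "\<dots> = real k * (\<Sum>\<nu><k. (\<Sum>l=1..m-1. ?S l * (?x \<nu> ^ (l - 1) * (?x \<nu> - ?x 1)\<^sup>2)) * E \<nu>)"
    by (subst sum.swap) (simp only: sum_distrib_left sum_distrib_right)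
  finally have "isop + curv = real k * (\<Sum>\<nu><k. mode_weight k m \<nu> * E \<nu>)"
    unfolding isop mode_weight_S_coeff[OF assms(2), symmetric]
    by (simp add: ring_distribs sum.distrib)
  moreover have "(\<Sum>\<nu><k. mode_weight k m \<nu> * E \<nu>) = (\<Sum>\<nu>\<in>{m<..<k-m}. mode_weight k m \<nu> * E \<nu>)"
  proof (intro sum.mono_neutral_right ballI)
    fix \<nu> assume \<nu>: "\<nu> \<in> {..<k} - {m<..<k-m}"
    \<comment> \<open>Coefficient \<open>0\<close> is the centroid. It has to be treated separately, since
      \<open>mode_weight k m 0 \<noteq> 0\<close>.\<close>
    have "fourier_coeff z 0 = 0"
      using assms(5) by (simp add: fourier_coeff_unity_root[OF z] unity_root_def)
    then show "mode_weight k m \<nu> * E \<nu> = 0"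
      using \<nu> mode_weight_zero[of \<nu> k m] by (cases "\<nu> = 0") (auto simp: E_def)
  qed auto
  ultimately have rhs: "isop + curv = real k * (\<Sum>\<nu>\<in>{m<..<k-m}. mode_weight k m \<nu> * E \<nu>)"
    by simp
  have nonneg: "mode_weight k m \<nu> * E \<nu> \<ge> 0" if "\<nu> \<in> {m<..<k-m}" for \<nu>
    using that mode_weight_pos[of m \<nu> k] by (simp add: E_def)
  have "isop + curv \<ge> 0"
    unfolding rhs by (intro mult_nonneg_nonneg sum_nonneg nonneg) auto
  moreover have "isop + curv = 0 \<longleftrightarrow> (\<forall>\<nu>\<in>{m<..<k-m}. mode_weight k m \<nu> * E \<nu> = 0)"
    unfolding rhs using k sum_nonneg_eq_0_iff[OF _ nonneg, of "{m<..<k-m}"] by simp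
  moreover have "mode_weight k m \<nu> * E \<nu> = 0 \<longleftrightarrow> fourier_coeff z \<nu> = 0"
    if "\<nu> \<in> {m<..<k-m}" for \<nu>
    using that mode_weight_pos[of m \<nu> k] by (simp add: E_def)
  ultimately have "0 \<le> isop + curv \<and>
      (isop + curv = 0 \<longleftrightarrow> (\<forall>\<nu>. m < \<nu> \<and> \<nu> < k - m \<longrightarrow> fourier_coeff z \<nu> = 0))"
    by (metis greaterThanLessThan_iff)
  then show ?thesis
    unfolding Let_def isop_def curv_def .
qed

end
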